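(* Let $X$ be a separable metric space. (i) If $f$ is a pointwise measure expansive homeomorphism of $X$, then for all $p,q\in X$ the set $A_f(p,q)$ of points positively asymptotic to $p$ and negatively asymptotic to $q$ under $f$ has measure zero with respect to any non-atomic Borel measure on $X$. (ii) If $f$ is a pointwise measure expansive uniform equivalence of $X$, then the set of all heteroclinic points of $f$ has measure zero with respect to any non-atomic Borel measure on $X$.
   Context: Let $(X,d)$ be a metric space. A Borel measure $\mu$ on $X$ is non-atomic if $\mu(\{x\})=0$ for every $x\in X$; $X$ is called non-atomic if there exists a non-atomic Borel measure on it. A bi-measurable map is a measurable bijection with measurable inverse. A uniform equivalence is a homeomorphism $f$ such that $f$ and $f^{-1}$ are uniformly continuous. For $\delta>0$, $\Gamma_\delta(x)=\{y\in X: d(f^n(x),f^n(y))\le\delta\text{ for all }n\in\mathbb{Z}\}$. A bi-measurable map $f$ on a non-atomic metric space $X$ is pointwise measure expansive if for each $x\in X$ there is $\delta_x>0$ (depending on $x$) such that $\mu(\Gamma_{\delta_x}(x))=0$ for any non-atomic Borel measure $\mu$. A point $y$ is positively asymptotic to $x$ under $f$ if for every $\epsilon>0$ there is a positive integer $N$ with $d(f^n(x),f^n(y))<\epsilon$ for all $n\ge N$; it is negatively asymptotic to $x$ if for every $\epsilon>0$ there is a positive integer $M$ with $d(f^n(x),f^n(y))<\epsilon$ for all $n\le -M$. $A_f(p,q)$ is the set of points positively asymptotic to $p$ and negatively asymptotic to $q$. The stable set of $x$ is $W^s(x)=\{y\in X:\text{for all }\epsilon>0\text{ there is }n\in\mathbb{N}\text{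 with }d(f^i(x),f^i(y))\le\epsilon\text{ for all }i\ge n\}$ and the unstable set is $W^u(x)=\{y\in X:\text{for all }\epsilon>0\text{ there is }n\in\mathbb{N}\text{ with }d(f^i(x),f^i(y))\le\epsilon\text{ for all }i\le -n\}$. For an orbit $O(p)$ put $W^s(O(p))=\bigcup_{z\in O(p)}W^s(z)$ and $W^u(O(p))=\bigcup_{z\in O(p)}W^u(z)$. A point $x$ is heteroclinic for $f$ if $x\in W^s(O(p))\cap W^u(O(q))$ for some periodic points $p,q$ of $f$. *)

theory Defs
  imports "HOL-Analysis.Analysis"
begin

text \<open>The metric space \<open>X\<close> is the type \<open>'a\<close>.  Borel measures are arbitrary countably additive
  measures on the Borel sets; they may be infinite, and need not even be sigma-finite.\<close>

definition nonatomic_borel_measure :: "'a::metric_space measure \<Rightarrow> bool" where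
  "nonatomic_borel_measure M \<longleftrightarrow> sets M = sets borel \<and> (\<forall>x. emeasure M {x} = 0)"

text \<open>The zero measure satisfies the previous definition; it must not count as a witness that a
  space is non-atomic, since otherwise every space would be.\<close>

definition nonatomic_space :: "'a::metric_space itself \<Rightarrow> bool" where
  "nonatomic_space (_ :: 'a itself) \<longleftrightarrow>
     (\<exists>M :: 'a measure. nonatomic_borel_measure M \<and> emeasure M UNIV \<noteq> 0)"

definition bi_measurable :: "('a::metric_space \<Rightarrow> 'a) \<Rightarrow> bool" where
  "bi_measurable f \<longleftrightarrow> bij f \<and> f \<in> borel \<rightarrow>\<^sub>M borel \<and> inv f \<in> borel \<rightarrow>\<^sub>M borel"

definition uniform_equivalence :: "('a::metric_space \<Rightarrow> 'a) \<Rightarrow> bool" where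
  "uniform_equivalence f \<longleftrightarrow> homeomorphism UNIV UNIV f (inv f) \<and>
     uniformly_continuous_on UNIV f \<and> uniformly_continuous_on UNIV (inv f)"

text \<open>The iterate of a bijection for an arbitrary integer exponent.\<close>

definition int_iter :: "('a \<Rightarrow> 'a) \<Rightarrow> int \<Rightarrow> 'a \<Rightarrow> 'a" where
  "int_iter f n = (if n \<ge> 0 then f ^^ nat n else inv f ^^ nat (- n))"

definition Gamma_set :: "('a::metric_space \<Rightarrow> 'a) \<Rightarrow> real \<Rightarrow> 'a \<Rightarrow> 'a set" where
  "Gamma_set f \<delta> x = {y. \<forall>n::int. dist (int_iter f n x) (int_iter f n y) \<le> \<delta>}"

text \<open>Null sets are expressed by membership in \<open>null_sets M\<close> rather than by \<open>emeasure M A = 0\<close>,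
  which also holds, by convention, for every non-measurable \<open>A\<close>.  The sets \<open>Gamma_set f \<delta> x\<close>
  are always Borel when \<open>f\<close> is bi-measurable.\<close>

definition pointwise_measure_expansive :: "('a::metric_space \<Rightarrow> 'a) \<Rightarrow> bool" where
  "pointwise_measure_expansive f \<longleftrightarrow>
     nonatomic_space TYPE('a) \<and> bi_measurable f \<and>
     (\<forall>x. \<exists>\<delta>>0. \<forall>M. nonatomic_borel_measure M \<longrightarrow> Gamma_set f \<delta> x \<in> null_sets M)"

definition pos_asymptotic :: "('a::metric_space \<Rightarrow> 'a) \<Rightarrow> 'a \<Rightarrow> 'a \<Rightarrow> bool" where
  "pos_asymptotic f x y \<longleftrightarrow>
     (\<forall>\<epsilon>>0. \<exists>N::int. N > 0 \<and> (\<forall>n\<ge>N. dist (int_iter f n x) (int_iter f n y) < \<epsilon>))"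

definition neg_asymptotic :: "('a::metric_space \<Rightarrow> 'a) \<Rightarrow> 'a \<Rightarrow> 'a \<Rightarrow> bool" where
  "neg_asymptotic f x y \<longleftrightarrow>
     (\<forall>\<epsilon>>0. \<exists>M::int. M > 0 \<and> (\<forall>n\<le>-M. dist (int_iter f n x) (int_iter f n y) < \<epsilon>))"

definition asymptotic_set :: "('a::metric_space \<Rightarrow> 'a) \<Rightarrow> 'a \<Rightarrow> 'a \<Rightarrow> 'a set" where
  "asymptotic_set f p q = {y. pos_asymptotic f p y \<and> neg_asymptotic f q y}"

definition stable_set :: "('a::metric_space \<Rightarrow> 'a) \<Rightarrow> 'a \<Rightarrow> 'a set" where
  "stable_set f x =
     {y. \<forall>\<epsilon>>0. \<exists>n::nat. \<forall>i\<ge>int n. dist (int_iter f i x) (int_iter f i y) \<le> \<epsilon>}"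

definition unstable_set :: "('a::metric_space \<Rightarrow> 'a) \<Rightarrow> 'a \<Rightarrow> 'a set" where
  "unstable_set f x =
     {y. \<forall>\<epsilon>>0. \<exists>n::nat. \<forall>i\<le>- int n. dist (int_iter f i x) (int_iter f i y) \<le> \<epsilon>}"

definition full_orbit :: "('a \<Rightarrow> 'a) \<Rightarrow> 'a \<Rightarrow> 'a set" where
  "full_orbit f p = range (\<lambda>n::int. int_iter f n p)"

definition periodic_point :: "('a \<Rightarrow> 'a) \<Rightarrow> 'a \<Rightarrow> bool" where
  "periodic_point f p \<longleftrightarrow> (\<exists>n::nat. n > 0 \<and> (f ^^ n) p = p)"

definition heteroclinic_point :: "('a::metric_space \<Rightarrow> 'a) \<Rightarrow> 'a \<Rightarrow> bool" where
  "heteroclinic_point f x \<longleftrightarrow> (\<exists>p q. periodic_point f p \<and> periodic_point f q \<and>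
     x \<in> (\<Union>z\<in>full_orbit f p. stable_set f z) \<inter> (\<Union>z\<in>full_orbit f q. unstable_set f z))"

end

theory Submission
  imports Defs
begin

text \<open>Everything follows from countability.  Measures may be infinite here, so on the Borel sets
  one may consider the measure that is \<open>0\<close> on countable sets and \<open>\<infinity>\<close> on all others.  It is
  non-atomic, and testing pointwise measure expansivity against it shows that each point \<open>x\<close> has
  some \<open>\<delta> > 0\<close> for which \<open>\<Gamma>\<^sub>\<delta>(x)\<close> is countable
  (\<open>pointwise_measure_expansive_imp_countable\<close>).

  Suppose next that, on a set \<open>S\<close>, staying \<open>\<delta>\<close>-close for all times is forced by staying
  \<open>\<delta>\<close>-close during a fixed finite window of times.  Since each iterate is continuous, every
  \<open>x \<in> S\<close> has a neighbourhood \<open>U\<close> with \<open>S \<inter> U \<subseteq> \<Gamma>\<^sub>\<delta>(x)\<close>, so \<open>S\<close> is locally countable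
  as soon as the sets \<open>\<Gamma>\<^sub>\<delta>(x)\<close> are countable; by separability \<open>S\<close> is countable
  (\<open>countable_if_window_controls\<close>).

  The value of \<open>\<delta>\<close> that makes \<open>\<Gamma>\<^sub>\<delta>(x)\<close> countable varies with \<open>x\<close>, but countably many values
  suffice, and so it may be fixed in each argument
  (\<open>countable_if_countable_at_scales\<close>).  For the fixed points of \<open>f\<^sup>n\<close> the times in \<open>[-n,n]\<close>
  control all others by periodicity, so there are only countably many periodic points.  The points of
  \<open>A\<^sub>f(p,q)\<close> whose forward orbit from time \<open>N\<close> on is \<open>\<delta>/2\<close>-close to that of \<open>p\<close>, and whose
  backward orbit from time \<open>-N\<close> on is \<open>\<delta>/2\<close>-close to that of \<open>q\<close>, are pairwise \<open>\<delta>\<close>-close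
  outside \<open>[-N,N]\<close>.  Finally, the heteroclinic points lie in the union of the sets
  \<open>A\<^sub>f(z,w)\<close>, where \<open>z\<close> and \<open>w\<close> range over the countably many points on periodic orbits.\<close>

section \<open>Countable sets and non-atomic measures\<close>

lemma countable_imp_null_nonatomic:
  assumes "nonatomic_borel_measure M" "countable A"
  shows "A \<in> null_sets M"
proof -
  have "(\<Union>x\<in>A. {x}) \<in> null_sets M"
    using assms by (intro null_sets_UN') (auto simp: nonatomic_borel_measure_def null_sets_def)
  then show ?thesis by simp
qed

definition uncountability_measure :: "'a::metric_space measure" where
  "uncountability_measure = measure_of UNIV (sets borel) (\<lambda>A. if countable A then 0 else \<infinity>)"

lemma emeasure_uncountability_measure:
  assumes "A \<in> sets borel"
  shows "emeasure uncountability_measure A = (if countable A then 0 else \<infinity>)"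
  unfolding uncountability_measure_def
proof (rule emeasure_measure_of_sigma)
  let ?\<mu> = "\<lambda>A::'a set. if countable A then 0 else \<infinity> :: ennreal"
  show "sigma_algebra UNIV (sets (borel :: 'a measure))"
    using sets.sigma_algebra_axioms[of "borel :: 'a measure"] by simp
  show "positive (sets borel) ?\<mu>" by (simp add: positive_def)
  show "countably_additive (sets borel) ?\<mu>"
  proof (rule countably_additiveI)
    fix B :: "nat \<Rightarrow> 'a set"
    show "(\<Sum>i. ?\<mu> (B i)) = ?\<mu> (\<Union>i. B i)"
    proof (cases "\<forall>i. countable (B i)")
      case True
      then show ?thesis by simp
    next
      case False
      then obtain j where j: "uncountable (B j)" by blast
      have "?\<mu> (B j) \<le> (\<Sum>i. ?\<mu> (B i))"
        using sum_le_suminf[of "\<lambda>i. ?\<mu> (B i)" "{j}"] by simp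
      moreover have "uncountable (\<Union>i. B i)"
        using j by (meson UNIV_I UN_upper countable_subset)
      ultimately show ?thesis using j by (simp add: top_unique)
    qed
  qed
qed (use assms in simp)

lemma nonatomic_uncountability_measure: "nonatomic_borel_measure uncountability_measure"
  using sets.sigma_sets_eq[of "borel :: 'a measure"]
  by (simp add: nonatomic_borel_measure_def emeasure_uncountability_measure)
     (simp add: uncountability_measure_def)

text \<open>Testing against \<open>uncountability_measure\<close> removes measures from the hypothesis.\<close>

lemma pointwise_measure_expansive_imp_countable:
  assumes "pointwise_measure_expansive f"
  obtains \<delta> where "\<delta> > 0" "countable (Gamma_set f \<delta> x)"
proof -
  obtain \<delta> where "\<delta> > 0" and "Gamma_set f \<delta> x \<in> null_sets uncountability_measure"
    using assms nonatomic_uncountability_measure unfolding pointwise_measure_expansive_def by blast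
  moreover from this(2) have "Gamma_set f \<delta> x \<in> sets borel"
    using nonatomic_uncountability_measure by (auto simp: nonatomic_borel_measure_def null_sets_def)
  ultimately show ?thesis
    using that by (auto simp: null_sets_def emeasure_uncountability_measure split: if_splits)
qed

text \<open>The parameter \<open>\<delta>\<close> varies with the point without any regularity.  Shrinking it to some
  \<open>1 / (k + 1)\<close> covers the space by countably many pieces on each of which one value serves for all points.\<close>

lemma countable_if_countable_at_scales:
  assumes "pointwise_measure_expansive f"
    and "\<And>\<delta>. \<delta> > 0 \<Longrightarrow> countable {x \<in> S. countable (Gamma_set f \<delta> x)}"
  shows "countable S"
proof -
  have "S \<subseteq> (\<Union>k. {x \<in> S. countable (Gamma_set f (inverse (real (Suc k))) x)})"
  proof
    fix x assume "x \<in> S"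
    obtain \<delta> where "\<delta> > 0" and \<delta>: "countable (Gamma_set f \<delta> x)"
      using pointwise_measure_expansive_imp_countable[OF assms(1)] .
    then obtain k where k: "inverse (real (Suc k)) < \<delta>" using reals_Archimedean by blast
    have "Gamma_set f (inverse (real (Suc k))) x \<subseteq> Gamma_set f \<delta> x"
      by (auto simp: Gamma_set_def intro: order_trans[OF _ less_imp_le[OF k]])
    then show "x \<in> (\<Union>k. {x \<in> S. countable (Gamma_set f (inverse (real (Suc k))) x)})"
      using \<open>x \<in> S\<close> countable_subset[OF _ \<delta>] by blast
  qed
  then show ?thesis
    by (rule countable_subset) (use assms(2) in auto)
qed

section \<open>Sets on which a finite window of times controls the whole orbit\<close>

text \<open>The balls of radius \<open>1 / (k + 1)\<close> around the points of a countable dense set form a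
  countable base, and those that meet \<open>S\<close> in a countable set cover \<open>S\<close>.\<close>

lemma countable_if_locally_countable:
  fixes S :: "'a::metric_space set"
  assumes "separable_space (euclidean :: 'a topology)"
    and loc: "\<And>x. x \<in> S \<Longrightarrow> \<exists>U. open U \<and> x \<in> U \<and> countable (S \<inter> U)"
  shows "countable S"
proof -
  obtain D :: "'a set" where D: "countable D" "closure D = UNIV"
    using assms(1) by (auto simp: separable_space_def)
  define \<B> where "\<B> = (\<lambda>(c, k). ball c (inverse (real (Suc k)))) ` (D \<times> (UNIV :: nat set))"
  have "countable \<B>" unfolding \<B>_def using D(1) by simp
  have "S \<subseteq> (\<Union>B \<in> {B \<in> \<B>. countable (S \<inter> B)}. S \<inter> B)"
  proof
    fix x assume "x \<in> S"
    then obtain U where U: "open U" "x \<in> U" "countable (S \<inter> U)" using loc by blast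
    obtain e where e: "e > 0" "ball x e \<subseteq> U" using U(1,2) openE by blast
    obtain k where k: "inverse (real (Suc k)) < e / 2"
      using e(1) reals_Archimedean[of "e / 2"] by auto
    obtain c where c: "c \<in> D" "dist c x < inverse (real (Suc k))"
      using D(2) closure_approachable[of x D]
      by (metis UNIV_I inverse_positive_iff_positive of_nat_0_less_iff zero_less_Suc)
    let ?B = "ball c (inverse (real (Suc k)))"
    have "?B \<subseteq> ball x e"
    proof
      fix y assume "y \<in> ?B"
      then show "y \<in> ball x e"
        using c(2) k dist_triangle[of x y c] by (simp add: dist_commute)
    qed
    then have "countable (S \<inter> ?B)"
      using e(2) U(3) countable_subset[of "S \<inter> ?B" "S \<inter> U"] by blast
    moreover have "?B \<in> \<B>" using c(1) by (auto simp: \<B>_def)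
    ultimately show "x \<in> (\<Union>B \<in> {B \<in> \<B>. countable (S \<inter> B)}. S \<inter> B)"
      using \<open>x \<in> S\<close> c(2) by auto
  qed
  then show ?thesis
    by (rule countable_subset[OF _ countable_UN]) (use \<open>countable \<B>\<close> in auto)
qed

lemma continuous_on_funpow:
  fixes f :: "'a::topological_space \<Rightarrow> 'a"
  assumes "continuous_on UNIV f"
  shows "continuous_on UNIV (f ^^ n)"
  by (induction n) (auto intro: continuous_on_compose2[OF assms])

lemma continuous_on_int_iter:
  assumes "homeomorphism UNIV UNIV f (inv f)"
  shows "continuous_on UNIV (int_iter f n)"
  using assms by (auto simp: int_iter_def homeomorphism_def intro: continuous_on_funpow)

lemma open_close_in_window:
  fixes f :: "'a::metric_space \<Rightarrow> 'a"
  assumes "homeomorphism UNIV UNIV f (inv f)" "\<delta> > 0"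
  obtains U where "open U" "x \<in> U"
    "\<And>y n. y \<in> U \<Longrightarrow> \<bar>n\<bar> \<le> N \<Longrightarrow> dist (int_iter f n x) (int_iter f n y) \<le> \<delta>"
proof
  let ?U = "\<Inter>n\<in>{-N..N}. int_iter f n -` ball (int_iter f n x) \<delta>"
  show "open ?U"
    using continuous_on_int_iter[OF assms(1)] by (auto intro!: open_INT open_vimage)
  show "x \<in> ?U" using assms(2) by auto
  show "dist (int_iter f n x) (int_iter f n y) \<le> \<delta>" if "y \<in> ?U" "\<bar>n\<bar> \<le> N" for y n
  proof -
    have "n \<in> {-N..N}" using that(2) by auto
    then have "int_iter f n y \<in> ball (int_iter f n x) \<delta>" using that(1) by blast
    then show ?thesis by simp
  qed
qed

text \<open>The window hypothesis turns a neighbourhood of \<open>x\<close> on which finitely many iterates stay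
  close into a neighbourhood whose trace on \<open>S\<close> lies in \<open>\<Gamma>\<^sub>\<delta>(x)\<close>.\<close>

lemma countable_if_window_controls:
  fixes f :: "'a::metric_space \<Rightarrow> 'a"
  assumes sep: "separable_space (euclidean :: 'a topology)"
    and f: "homeomorphism UNIV UNIV f (inv f)"
    and "\<delta> > 0"
    and count: "\<And>x. x \<in> S \<Longrightarrow> countable (Gamma_set f \<delta> x)"
    and window: "\<And>x y n. \<lbrakk>x \<in> S; y \<in> S;
        \<And>m. \<bar>m\<bar> \<le> N \<Longrightarrow> dist (int_iter f m x) (int_iter f m y) \<le> \<delta>\<rbrakk>
      \<Longrightarrow> dist (int_iter f n x) (int_iter f n y) \<le> \<delta>"
  shows "countable S"
proof (rule countable_if_locally_countable[OF sep])
  fix x assume x: "x \<in> S"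
  obtain U where U: "open U" "x \<in> U"
    "\<And>y n. y \<in> U \<Longrightarrow> \<bar>n\<bar> \<le> N \<Longrightarrow> dist (int_iter f n x) (int_iter f n y) \<le> \<delta>"
    using open_close_in_window[OF f \<open>\<delta> > 0\<close>] by metis
  have "S \<inter> U \<subseteq> Gamma_set f \<delta> x"
    using window x U(3) by (auto simp: Gamma_set_def)
  then have "countable (S \<inter> U)" using count[OF x] by (rule countable_subset)
  with U show "\<exists>U. open U \<and> x \<in> U \<and> countable (S \<inter> U)" by blast
qed

section \<open>Points asymptotic to given orbits\<close>

lemma asymptotic_setD:
  assumes "y \<in> asymptotic_set f p q" "\<epsilon> > 0"
  obtains N :: nat where
    "\<And>n. n > int N \<Longrightarrow> dist (int_iter f n p) (int_iter f n y) \<le> \<epsilon>"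
    "\<And>n. n < - int N \<Longrightarrow> dist (int_iter f n q) (int_iter f n y) \<le> \<epsilon>"
proof -
  obtain K where K: "\<And>n. n \<ge> K \<Longrightarrow> dist (int_iter f n p) (int_iter f n y) < \<epsilon>"
    using assms unfolding asymptotic_set_def pos_asymptotic_def by blast
  obtain L where L: "\<And>n. n \<le> - L \<Longrightarrow> dist (int_iter f n q) (int_iter f n y) < \<epsilon>"
    using assms unfolding asymptotic_set_def neg_asymptotic_def by blast
  show ?thesis
  proof (rule that[of "nat (max K L)"])
    show "dist (int_iter f n p) (int_iter f n y) \<le> \<epsilon>" if "n > int (nat (max K L))" for n
      using K[of n] that by linarith
    show "dist (int_iter f n q) (int_iter f n y) \<le> \<epsilon>" if "n < - int (nat (max K L))" for n
      using L[of n] that by linarith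
  qed
qed

lemma countable_asymptotic_set:
  fixes f :: "'a::metric_space \<Rightarrow> 'a"
  assumes sep: "separable_space (euclidean :: 'a topology)"
    and f: "homeomorphism UNIV UNIV f (inv f)" "pointwise_measure_expansive f"
  shows "countable (asymptotic_set f p q)"
proof (rule countable_if_countable_at_scales[OF f(2)])
  fix \<delta> :: real assume \<delta>: "\<delta> > 0"
  define T where "T N = {y. countable (Gamma_set f \<delta> y) \<and>
      (\<forall>n>int N. dist (int_iter f n p) (int_iter f n y) \<le> \<delta> / 2) \<and>
      (\<forall>n < - int N. dist (int_iter f n q) (int_iter f n y) \<le> \<delta> / 2)}" for N
  have "countable (T N)" for N
  proof (rule countable_if_window_controls[OF sep f(1) \<delta>, where N = "int N"])
    fix x y n
    assume xy: "x \<in> T N" "y \<in> T N"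
      and window: "\<And>m. \<bar>m\<bar> \<le> int N \<Longrightarrow> dist (int_iter f m x) (int_iter f m y) \<le> \<delta>"
    consider "\<bar>n\<bar> \<le> int N" | "n > int N" | "n < - int N" by linarith
    then show "dist (int_iter f n x) (int_iter f n y) \<le> \<delta>"
    proof cases
      case 1
      then show ?thesis by (rule window)
    next
      case 2
      then have "dist (int_iter f n p) (int_iter f n x) \<le> \<delta> / 2"
        "dist (int_iter f n p) (int_iter f n y) \<le> \<delta> / 2"
        using xy by (auto simp: T_def)
      then show ?thesis
        using dist_triangle3[of "int_iter f n x" "int_iter f n y" "int_iter f n p"] by linarith
    next
      case 3
      then have "dist (int_iter f n q) (int_iter f n x) \<le> \<delta> / 2"
        "dist (int_iter f n q) (int_iter f n y) \<le> \<delta> / 2"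
        using xy by (auto simp: T_def)
      then show ?thesis
        using dist_triangle3[of "int_iter f n x" "int_iter f n y" "int_iter f n q"] by linarith
    qed
  qed (simp add: T_def)
  then have "countable (\<Union>N. T N)" by simp
  moreover have "{y \<in> asymptotic_set f p q. countable (Gamma_set f \<delta> y)} \<subseteq> (\<Union>N. T N)"
  proof safe
    fix y assume y: "y \<in> asymptotic_set f p q" "countable (Gamma_set f \<delta> y)"
    have "\<delta> / 2 > 0" using \<delta> by simp
    then obtain N where "\<And>n. n > int N \<Longrightarrow> dist (int_iter f n p) (int_iter f n y) \<le> \<delta> / 2"
      "\<And>n. n < - int N \<Longrightarrow> dist (int_iter f n q) (int_iter f n y) \<le> \<delta> / 2"
      using asymptotic_setD[OF y(1)] by metis
    then show "y \<in> (\<Union>N. T N)" using y(2) by (auto simp: T_def)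
  qed
  ultimately show "countable {y \<in> asymptotic_set f p q. countable (Gamma_set f \<delta> y)}"
    by (rule countable_subset[rotated])
qed

section \<open>Periodic and heteroclinic points\<close>

text \<open>Reduction of the exponent modulo \<open>n\<close>, which for negative exponents uses that a fixed point
  of \<open>f\<^sup>n\<close> is also one of its inverse.  The reduced exponent depends only on \<open>m\<close>, so that the
  orbits of two fixed points can be compared at the same time.\<close>

lemma int_iter_periodic:
  assumes "bij f" "n > 0"
  obtains k where "\<bar>k\<bar> \<le> int n" "\<And>r. (f ^^ n) r = r \<Longrightarrow> int_iter f m r = int_iter f k r"
proof (cases "m \<ge> 0")
  case True
  show ?thesis
  proof (rule that[of "int (nat m mod n)"])
    show "\<bar>int (nat m mod n)\<bar> \<le> int n"
      using mod_less_divisor[OF \<open>n > 0\<close>, of "nat m"] by linarith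
    show "int_iter f m r = int_iter f (int (nat m mod n)) r" if "(f ^^ n) r = r" for r
      using funpow_mod_eq[OF that, of "nat m"] True by (simp add: int_iter_def)
  qed
next
  case False
  show ?thesis
  proof (rule that[of "- int (nat (- m) mod n)"])
    show "\<bar>- int (nat (- m) mod n)\<bar> \<le> int n"
      using mod_less_divisor[OF \<open>n > 0\<close>, of "nat (- m)"] by linarith
    fix r assume r: "(f ^^ n) r = r"
    have "inv (f ^^ n) r = r"
      using bij_is_inj[OF bij_fn[OF \<open>bij f\<close>]] r by (rule inv_f_eq)
    then have "(inv f ^^ n) r = r" using inv_fn[OF \<open>bij f\<close>] by simp
    from funpow_mod_eq[OF this, of "nat (- m)"]
    have "(inv f ^^ nat (- m)) r = (inv f ^^ (nat (- m) mod n)) r" by simp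
    then show "int_iter f m r = int_iter f (- int (nat (- m) mod n)) r"
      using False by (cases "nat (- m) mod n") (simp_all add: int_iter_def del: of_nat_Suc)
  qed
qed

lemma countable_periodic_points:
  fixes f :: "'a::metric_space \<Rightarrow> 'a"
  assumes sep: "separable_space (euclidean :: 'a topology)"
    and f: "homeomorphism UNIV UNIV f (inv f)" "pointwise_measure_expansive f"
  shows "countable {p. periodic_point f p}"
proof -
  have "bij f" using f(2) by (simp add: pointwise_measure_expansive_def bi_measurable_def)
  have "countable {p. (f ^^ n) p = p}" if "n > 0" for n
  proof (rule countable_if_countable_at_scales[OF f(2)])
    fix \<delta> :: real assume "\<delta> > 0"
    then show "countable {p \<in> {p. (f ^^ n) p = p}. countable (Gamma_set f \<delta> p)}"
    proof (rule countable_if_window_controls[OF sep f(1), where N = "int n"])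
      fix x y m
      assume "x \<in> {p \<in> {p. (f ^^ n) p = p}. countable (Gamma_set f \<delta> p)}"
        "y \<in> {p \<in> {p. (f ^^ n) p = p}. countable (Gamma_set f \<delta> p)}"
        and window: "\<And>k. \<bar>k\<bar> \<le> int n \<Longrightarrow> dist (int_iter f k x) (int_iter f k y) \<le> \<delta>"
      then have xy: "(f ^^ n) x = x" "(f ^^ n) y = y" by auto
      obtain k where "\<bar>k\<bar> \<le> int n" "\<And>r. (f ^^ n) r = r \<Longrightarrow> int_iter f m r = int_iter f k r"
        using int_iter_periodic[OF \<open>bij f\<close> \<open>n > 0\<close>] by metis
      then show "dist (int_iter f m x) (int_iter f m y) \<le> \<delta>"
        using window[of k] xy by simp
    qed auto
  qed
  then have "countable (\<Union>n\<in>{0<..}. {p. (f ^^ n) p = p})"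
    by (intro countable_UN) auto
  moreover have "{p. periodic_point f p} = (\<Union>n\<in>{0<..}. {p. (f ^^ n) p = p})"
    by (auto simp: periodic_point_def)
  ultimately show ?thesis by simp
qed

text \<open>Stable and unstable sets are classes of asymptotic points: replacing \<open>\<epsilon>\<close> by
  \<open>\<epsilon> / 2\<close> makes the inequality strict, and increasing the time by one makes it positive.\<close>

lemma stable_unstable_subset_asymptotic:
  "stable_set f z \<inter> unstable_set f w \<subseteq> asymptotic_set f z w"
proof
  fix y assume y: "y \<in> stable_set f z \<inter> unstable_set f w"
  have "pos_asymptotic f z y"
    unfolding pos_asymptotic_def
  proof (intro allI impI)
    fix \<epsilon> :: real assume "\<epsilon> > 0"
    then obtain n :: nat
      where n: "\<forall>i\<ge>int n. dist (int_iter f i z) (int_iter f i y) \<le> \<epsilon> / 2"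
      using y unfolding stable_set_def by (auto dest!: spec[of _ "\<epsilon> / 2"])
    have "dist (int_iter f i z) (int_iter f i y) < \<epsilon>" if "i \<ge> int n + 1" for i
      using n[rule_format, of i] that \<open>\<epsilon> > 0\<close> by linarith
    then show "\<exists>N::int. N > 0 \<and> (\<forall>i\<ge>N. dist (int_iter f i z) (int_iter f i y) < \<epsilon>)"
      by (intro exI[of _ "int n + 1"]) auto
  qed
  moreover have "neg_asymptotic f w y"
    unfolding neg_asymptotic_def
  proof (intro allI impI)
    fix \<epsilon> :: real assume "\<epsilon> > 0"
    then obtain n :: nat
      where n: "\<forall>i\<le>- int n. dist (int_iter f i w) (int_iter f i y) \<le> \<epsilon> / 2"
      using y unfolding unstable_set_def by (auto dest!: spec[of _ "\<epsilon> / 2"])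
    have "dist (int_iter f i w) (int_iter f i y) < \<epsilon>" if "i \<le> - (int n + 1)" for i
      using n[rule_format, of i] that \<open>\<epsilon> > 0\<close> by linarith
    then show "\<exists>M::int. M > 0 \<and> (\<forall>i\<le>- M. dist (int_iter f i w) (int_iter f i y) < \<epsilon>)"
      by (intro exI[of _ "int n + 1"]) auto
  qed
  ultimately show "y \<in> asymptotic_set f z w" by (simp add: asymptotic_set_def)
qed

lemma countable_heteroclinic_points:
  fixes f :: "'a::metric_space \<Rightarrow> 'a"
  assumes sep: "separable_space (euclidean :: 'a topology)"
    and f: "homeomorphism UNIV UNIV f (inv f)" "pointwise_measure_expansive f"
  shows "countable {x. heteroclinic_point f x}"
proof -
  define P where "P = (\<Union>p\<in>{p. periodic_point f p}. full_orbit f p)"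
  have "countable P"
    unfolding P_def full_orbit_def using countable_periodic_points[OF assms] by simp
  then have "countable (\<Union>z\<in>P. \<Union>w\<in>P. asymptotic_set f z w)"
    using countable_asymptotic_set[OF assms] by simp
  moreover have "{x. heteroclinic_point f x} \<subseteq> (\<Union>z\<in>P. \<Union>w\<in>P. asymptotic_set f z w)"
    unfolding heteroclinic_point_def P_def using stable_unstable_subset_asymptotic[of f] by blast
  ultimately show ?thesis by (rule countable_subset[rotated])
qed

theorem corollary3p9:
  assumes "separable_space (euclidean :: 'a::metric_space topology)"
  shows "(\<forall>f :: 'a \<Rightarrow> 'a.
            homeomorphism UNIV UNIV f (inv f) \<and> pointwise_measure_expansive f \<longrightarrow>
            (\<forall>p q. \<forall>M. nonatomic_borel_measure M \<longrightarrow> asymptotic_set f p q \<in> null_sets M))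
       \<and> (\<forall>f :: 'a \<Rightarrow> 'a.
            uniform_equivalence f \<and> pointwise_measure_expansive f \<longrightarrow>
            (\<forall>M. nonatomic_borel_measure M \<longrightarrow> {x. heteroclinic_point f x} \<in> null_sets M))"
proof (intro conjI allI impI; elim conjE)
  fix f :: "'a \<Rightarrow> 'a" and M :: "'a measure"
  assume M: "nonatomic_borel_measure M" and f: "pointwise_measure_expansive f"
  show "asymptotic_set f p q \<in> null_sets M" if "homeomorphism UNIV UNIV f (inv f)" for p q
    using countable_imp_null_nonatomic[OF M countable_asymptotic_set[OF assms that f]] .
  show "{x. heteroclinic_point f x} \<in> null_sets M" if "uniform_equivalence f"
    using that countable_imp_null_nonatomic[OF M countable_heteroclinic_points[OF assms _ f]]
    by (simp add: uniform_equivalence_def)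
qed

end
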